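(* Suppose that the optimal control $u(t)$ for Problem (Pc) is singular over some interval $[\zeta_1,\zeta_2)\subset[t_{i-1},t_i)$ (with $\zeta_1<\zeta_2$ and $i\in\{1,\dots,N\}$). Then (a) $\rho_i=\lambda_0>0$, i.e., the problem is normal; (b) $\theta(t)$ is constant, i.e., $u(t)=0$, for all $t\in[\zeta_1,\zeta_2)$.
   Context: Fix an integer $N\ge1$, a real $a>0$, points $p_i=(x_i,y_i)\in\mathbb{R}^2$, $i=0,\dots,N$, with $p_{i-1}\neq p_i$, and angles $\theta_0,\theta_f\in\mathbb{R}$. Problem (Pc): minimize $t_N$ over node times $0=t_0<t_1<\dots<t_N$ (free), measurable controls $u$ with $|u(t)|\le a$ a.e., and states $x,y,\theta$ with $\dot x=\cos\theta$, $\dot y=\sin\theta$, $\dot\theta=u$ on $[0,t_N]$, $(x(t_i),y(t_i))=p_i$ for $i=0,\dots,N$, $\theta(0)=\theta_0$, $\theta(t_N)=\theta_f$. Controls are identified up to null sets. Necessary conditions (maximum principle): for an optimal solution there exist a number $\lambda_0\ge0$, real constants $\overline\lambda_1^i,\overline\lambda_2^i$ ($i=1,\dots,N$), and a continuous function $\lambda_3:[0,t_N]\to\mathbb{R}$, Lipschitz on each stage, such that for every $i=1,\dots,N$: (1) $(\lambda_0,\overline\lambda_1^i,\overline\lambda_2^i,\lambda_3(t))\neq 0$ for all $t\in[t_{i-1},t_i]$; (2) $\dot\lambda_3(t)=\overline\lambda_1^i\sin\theta(t)-\overline\lambda_2^i\cos\theta(t)$ on $[t_{i-1},t_i]$; (3)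 for a.e. $t\in[t_{i-1},t_i)$, $u(t)=a$ if $\lambda_3(t)<0$, $u(t)=-a$ if $\lambda_3(t)>0$ ($u(t)$ is undetermined in $[-a,a]$ if $\lambda_3(t)=0$); (4) $\lambda_0+\overline\lambda_1^i\cos\theta(t)+\overline\lambda_2^i\sin\theta(t)+\lambda_3(t)u(t)=0$ on $[t_{i-1},t_i)$. The optimal solution is considered together with such multipliers, and $\rho_i:=\sqrt{(\overline\lambda_1^i)^2+(\overline\lambda_2^i)^2}$. The control is singular over an interval if $\lambda_3(t)=0$ for all $t$ in that interval. The problem is normal if $\lambda_0>0$ and abnormal if $\lambda_0=0$. *)

theory Defs
  imports "HOL-Analysis.Analysis"
begin

text \<open>
  Problem (Pc).  Node times are \<open>\<tau> 0, \<dots>, \<tau> N\<close>; functions of time are total functions on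
  the reals of which only the values on \<open>[0, \<tau> N]\<close> matter.
\<close>

text \<open>
  The right-hand side may be merely measurable, so a differential equation is understood in the
  Caratheodory sense.  All right-hand sides in this development are essentially bounded, hence
  the absolutely continuous solutions are exactly the Lipschitz ones.
\<close>

definition solves_ode_ae :: "(real \<Rightarrow> real) \<Rightarrow> (real \<Rightarrow> real) \<Rightarrow> real \<Rightarrow> bool" where
  "solves_ode_ae f g T \<longleftrightarrow>
     (\<exists>L. L-lipschitz_on {0..T} f) \<and>
     (AE t in lebesgue_on {0..T}. (f has_real_derivative g t) (at t within {0..T}))"

definition feasible_Pc ::
  "nat \<Rightarrow> real \<Rightarrow> (nat \<Rightarrow> real \<times> real) \<Rightarrow> real \<Rightarrow> real \<Rightarrow>
   (nat \<Rightarrow> real) \<Rightarrow> (real \<Rightarrow> real) \<Rightarrow> (real \<Rightarrow> real) \<Rightarrow> (real \<Rightarrow> real) \<Rightarrow> (real \<Rightarrow> real) \<Rightarrow> bool"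
where
  "feasible_Pc N a p \<theta>\<^sub>0 \<theta>\<^sub>f \<tau> u x y \<theta> \<longleftrightarrow>
     \<tau> 0 = 0 \<and> (\<forall>i\<in>{1..N}. \<tau> (i - 1) < \<tau> i) \<and>
     u \<in> borel_measurable (lebesgue_on {0..\<tau> N}) \<and>
     (AE t in lebesgue_on {0..\<tau> N}. \<bar>u t\<bar> \<le> a) \<and>
     solves_ode_ae x (\<lambda>t. cos (\<theta> t)) (\<tau> N) \<and>
     solves_ode_ae y (\<lambda>t. sin (\<theta> t)) (\<tau> N) \<and>
     solves_ode_ae \<theta> u (\<tau> N) \<and>
     (\<forall>i\<in>{0..N}. (x (\<tau> i), y (\<tau> i)) = p i) \<and>
     \<theta> 0 = \<theta>\<^sub>0 \<and> \<theta> (\<tau> N) = \<theta>\<^sub>f"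

definition optimal_Pc ::
  "nat \<Rightarrow> real \<Rightarrow> (nat \<Rightarrow> real \<times> real) \<Rightarrow> real \<Rightarrow> real \<Rightarrow>
   (nat \<Rightarrow> real) \<Rightarrow> (real \<Rightarrow> real) \<Rightarrow> (real \<Rightarrow> real) \<Rightarrow> (real \<Rightarrow> real) \<Rightarrow> (real \<Rightarrow> real) \<Rightarrow> bool"
where
  "optimal_Pc N a p \<theta>\<^sub>0 \<theta>\<^sub>f \<tau> u x y \<theta> \<longleftrightarrow>
     feasible_Pc N a p \<theta>\<^sub>0 \<theta>\<^sub>f \<tau> u x y \<theta> \<and>
     (\<forall>\<tau>' u' x' y' \<theta>'. feasible_Pc N a p \<theta>\<^sub>0 \<theta>\<^sub>f \<tau>' u' x' y' \<theta>' \<longrightarrow> \<tau> N \<le> \<tau>' N)"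

text \<open>
  The multipliers \<open>l0, l1, l2, l3\<close> of the maximum principle; \<open>l1 i\<close> and \<open>l2 i\<close> are the constant
  values on stage \<open>i\<close>.  Conditions that involve the control are imposed almost everywhere only,
  since controls are identified up to null sets.
\<close>

definition pmp_multipliers ::
  "nat \<Rightarrow> real \<Rightarrow> (nat \<Rightarrow> real) \<Rightarrow> (real \<Rightarrow> real) \<Rightarrow> (real \<Rightarrow> real) \<Rightarrow>
   real \<Rightarrow> (nat \<Rightarrow> real) \<Rightarrow> (nat \<Rightarrow> real) \<Rightarrow> (real \<Rightarrow> real) \<Rightarrow> bool"
where
  "pmp_multipliers N a \<tau> u \<theta> l0 l1 l2 l3 \<longleftrightarrow>
     l0 \<ge> 0 \<and> continuous_on {0..\<tau> N} l3 \<and>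
     (\<forall>i\<in>{1..N}.
        (\<exists>L. L-lipschitz_on {\<tau> (i - 1)..\<tau> i} l3) \<and>
        (\<forall>t\<in>{\<tau> (i - 1)..\<tau> i}. (l0, l1 i, l2 i, l3 t) \<noteq> (0, 0, 0, 0)) \<and>
        (\<forall>t\<in>{\<tau> (i - 1)..\<tau> i}.
           (l3 has_real_derivative l1 i * sin (\<theta> t) - l2 i * cos (\<theta> t))
             (at t within {\<tau> (i - 1)..\<tau> i})) \<and>
        (AE t in lebesgue_on {\<tau> (i - 1)..<\<tau> i}.
           (l3 t < 0 \<longrightarrow> u t = a) \<and> (l3 t > 0 \<longrightarrow> u t = - a)) \<and>
        (AE t in lebesgue_on {\<tau> (i - 1)..<\<tau> i}.
           l0 + l1 i * cos (\<theta> t) + l2 i * sin (\<theta> t) + l3 t * u t = 0))"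

definition rho :: "(nat \<Rightarrow> real) \<Rightarrow> (nat \<Rightarrow> real) \<Rightarrow> nat \<Rightarrow> real" where
  "rho l1 l2 i = sqrt ((l1 i)\<^sup>2 + (l2 i)\<^sup>2)"

definition singular_over :: "(real \<Rightarrow> real) \<Rightarrow> real set \<Rightarrow> bool" where
  "singular_over l3 I \<longleftrightarrow> (\<forall>t\<in>I. l3 t = 0)"

definition normal_Pc :: "real \<Rightarrow> bool" where
  "normal_Pc l0 \<longleftrightarrow> l0 > 0"

end

theory Submission
  imports Defs
begin

text \<open>
  Along a singular arc the switching function \<open>l3\<close> vanishes together with its derivative, so the
  vector \<open>(l1, l2)\<close> is parallel to the heading \<open>(cos \<theta>, sin \<theta>)\<close>; this leaves a discrete set of
  values for the continuous function \<open>\<theta>\<close>. The vanishing Hamiltonian fixes the component of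
  \<open>(l1, l2)\<close> along the heading to be \<open>- l0\<close>, and nontriviality of the multipliers excludes \<open>l0 = 0\<close>.
\<close>

lemma AE_lebesgue_on_subset:
  assumes "AE t in lebesgue_on T. P t" and "S \<subseteq> T" and "S \<in> sets lebesgue" "T \<in> sets lebesgue"
  shows "AE t in lebesgue_on S. P t"
  using assms by (auto simp: AE_restrict_space_iff elim!: eventually_mono)

text \<open>A nonempty half-open interval has positive measure, so its almost-everywhere filter is
  proper. This extracts one concrete time from conditions imposed only almost everywhere.\<close>

lemma AE_lebesgue_on_Ico_witness:
  fixes a b :: real
  assumes "a < b" and "AE t in lebesgue_on {a..<b}. P t"
  obtains t where "t \<in> {a..<b}" "P t"
proof -
  have "emeasure (lebesgue_on {a..<b}) (space (lebesgue_on {a..<b})) \<noteq> 0"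
    using \<open>a < b\<close> by (simp add: emeasure_restrict_space)
  then have "ae_filter (lebesgue_on {a..<b}) \<noteq> bot"
    by (metis ae_filter_eq_bot_iff)
  moreover have "AE t in lebesgue_on {a..<b}. P t \<and> t \<in> {a..<b}"
    using assms(2) AE_space by eventually_elim simp
  ultimately show ?thesis
    using that eventually_happens by blast
qed

text \<open>Shrinking the domain to the interval keeps the derivative, and there it is unique
  because no point of the interval is isolated. Leaving \<open>T\<close> free serves both
  \<open>l3\<close> on its stage and \<open>\<theta>\<close> on the whole horizon.\<close>

lemma has_real_derivative_Ico_const_unique:
  fixes f :: "real \<Rightarrow> real"
  assumes "(f has_real_derivative D) (at t within T)" and "{a..<b} \<subseteq> T" and "t \<in> {a..<b}"
    and "\<And>s. s \<in> {a..<b} \<Longrightarrow> f s = c"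
  shows "D = 0"
proof -
  have "((\<lambda>s. c) has_real_derivative D) (at t within {a..<b})"
    using DERIV_subset[OF assms(1,2)]
    by (rule has_field_derivative_transform_within[OF _ zero_less_one]) (use assms in auto)
  moreover have "((\<lambda>s. c) has_real_derivative 0) (at t within {a..<b})"
    by simp
  moreover have "at t within {a..<b} \<noteq> bot"
  proof -
    \<comment> \<open>Approaching from the right also covers the left endpoint
      \<open>t = a\<close>.\<close>
    have "t islimpt {t<..<b}"
      using assms(3) by (simp add: islimpt_greaterThanLessThan1)
    then have "t islimpt {a..<b}"
      by (rule islimpt_subset) (use assms(3) in auto)
    then show ?thesis
      by (simp add: trivial_limit_within)
  qed
  ultimately show ?thesis
    using has_field_derivative_unique by blast
qed

text \<open>Two unit vectors parallel to the same nonzero vector \<open>(l, m)\<close> agree up to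
  sign, so their angles differ by a multiple of \<open>pi\<close>.\<close>

lemma sin_diff_eq_0_if_parallel:
  fixes l m s t :: real
  assumes "(l, m) \<noteq> (0, 0)" and "l * sin s = m * cos s" and "l * sin t = m * cos t"
  shows "sin (t - s) = 0"
proof -
  have "l * sin (t - s) = 0" "m * sin (t - s) = 0"
    using assms(2,3) by (simp_all add: sin_diff algebra_simps) (algebra+)
  then show ?thesis
    using assms(1) by auto
qed

text \<open>Distinct values of \<open>f\<close> differ by a nonzero multiple of \<open>pi\<close>,
  hence by at least \<open>pi\<close>; a continuous function with such a discrete range cannot jump
  on a connected set.\<close>

lemma constant_on_if_sin_diff_eq_0:
  fixes f :: "real \<Rightarrow> real"
  assumes "connected S" and "continuous_on S f"
    and "\<And>s t. s \<in> S \<Longrightarrow> t \<in> S \<Longrightarrow> sin (f t - f s) = 0"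
  shows "f constant_on S"
proof (rule continuous_discrete_range_constant[OF assms(1,2)])
  fix s assume s: "s \<in> S"
  have "pi \<le> norm (f t - f s)" if t: "t \<in> S" "f t \<noteq> f s" for t
  proof -
    obtain k :: int where k: "f t - f s = of_int k * pi"
      using assms(3)[OF s t(1)] unfolding sin_zero_iff_int2 by blast
    with t(2) have "1 \<le> \<bar>real_of_int k\<bar>"
      by (cases "k = 0") auto
    then show ?thesis
      using k by (simp add: abs_mult)
  qed
  then show "\<exists>e>0. \<forall>t. t \<in> S \<and> f t \<noteq> f s \<longrightarrow> e \<le> norm (f t - f s)"
    using pi_gt_zero by blast
qed

theorem lemma1:
  fixes N i :: nat
    and a \<theta>\<^sub>0 \<theta>\<^sub>f l0 \<zeta>\<^sub>1 \<zeta>\<^sub>2 :: real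
    and p :: "nat \<Rightarrow> real \<times> real"
    and \<tau> l1 l2 :: "nat \<Rightarrow> real"
    and u x y \<theta> l3 :: "real \<Rightarrow> real"
  assumes "N \<ge> 1" and "a > 0"
    and "\<forall>j\<in>{1..N}. p (j - 1) \<noteq> p j"
    and "optimal_Pc N a p \<theta>\<^sub>0 \<theta>\<^sub>f \<tau> u x y \<theta>"
    and "pmp_multipliers N a \<tau> u \<theta> l0 l1 l2 l3"
    and "i \<in> {1..N}" and "\<zeta>\<^sub>1 < \<zeta>\<^sub>2"
    and "{\<zeta>\<^sub>1..<\<zeta>\<^sub>2} \<subseteq> {\<tau> (i - 1)..<\<tau> i}"
    and "singular_over l3 {\<zeta>\<^sub>1..<\<zeta>\<^sub>2}"
  shows "(rho l1 l2 i = l0 \<and> l0 > 0 \<and> normal_Pc l0) \<and>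
         (\<theta> constant_on {\<zeta>\<^sub>1..<\<zeta>\<^sub>2} \<and> (AE t in lebesgue_on {\<zeta>\<^sub>1..<\<zeta>\<^sub>2}. u t = 0))"
proof -
  define I where "I = {\<zeta>\<^sub>1..<\<zeta>\<^sub>2}"
  define A where "A = {\<tau> (i - 1)..\<tau> i}"
  have feas: "feasible_Pc N a p \<theta>\<^sub>0 \<theta>\<^sub>f \<tau> u x y \<theta>"
    using assms(4) by (simp add: optimal_Pc_def)
  have nodes: "\<tau> (j - 1) < \<tau> j" if "j \<in> {1..N}" for j
    using feas that by (simp add: feasible_Pc_def)
  have mono: "\<tau> j \<le> \<tau> k" if "j \<le> k" "k \<le> N" for j k
    using that
  proof (induction k rule: dec_induct)
    case (step k)
    then have "\<tau> k < \<tau> (Suc k)"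
      using nodes[of "Suc k"] by simp
    then show ?case
      using step.IH step.prems by simp
  qed simp
  have "0 \<le> \<tau> (i - 1)" "\<tau> i \<le> \<tau> N"
    using mono[of 0 "i - 1"] mono[of i N] feas assms(6) by (auto simp: feasible_Pc_def)
  then have IT: "I \<subseteq> {0..\<tau> N}" and IA: "I \<subseteq> A" and IA': "I \<subseteq> {\<tau> (i - 1)..<\<tau> i}"
    using assms(8) by (force simp: I_def A_def)+
  have meas: "I \<in> sets lebesgue"
    by (simp add: I_def)
  have ode: "solves_ode_ae \<theta> u (\<tau> N)"
    using feas by (simp add: feasible_Pc_def)
  have l3: "l3 t = 0" if "t \<in> I" for t
    using assms(9) that by (simp add: singular_over_def I_def)
  have l0: "l0 \<ge> 0"
    and nontriv: "\<And>t. t \<in> A \<Longrightarrow> (l0, l1 i, l2 i, l3 t) \<noteq> (0, 0, 0, 0)"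
    and der: "\<And>t. t \<in> A \<Longrightarrow>
      (l3 has_real_derivative l1 i * sin (\<theta> t) - l2 i * cos (\<theta> t)) (at t within A)"
    and ham: "AE t in lebesgue_on {\<tau> (i - 1)..<\<tau> i}.
      l0 + l1 i * cos (\<theta> t) + l2 i * sin (\<theta> t) + l3 t * u t = 0"
    using assms(5,6) unfolding pmp_multipliers_def A_def by blast+
  \<comment> \<open>The adjoint equation is evaluated where \<open>l3\<close> is identically zero,
    so its right-hand side vanishes.\<close>
  have par: "l1 i * sin (\<theta> t) = l2 i * cos (\<theta> t)" if "t \<in> I" for t
    using has_real_derivative_Ico_const_unique[of l3 _ t A \<zeta>\<^sub>1 \<zeta>\<^sub>2 0] der[of t] IA that l3
    by (force simp: I_def)
  have "AE t in lebesgue_on I. l0 + l1 i * cos (\<theta> t) + l2 i * sin (\<theta> t) + l3 t * u t = 0"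
    using ham IA' meas by (rule AE_lebesgue_on_subset) simp
  \<comment> \<open>A single time suffices, since \<open>l0\<close>, \<open>l1 i\<close> and
    \<open>l2 i\<close> do not depend on it; the unknown \<open>u t\<close> drops out as
    \<open>l3 t = 0\<close>.\<close>
  then obtain t where t: "t \<in> I"
    and "l0 + l1 i * cos (\<theta> t) + l2 i * sin (\<theta> t) + l3 t * u t = 0"
    using AE_lebesgue_on_Ico_witness[OF assms(7)] unfolding I_def by blast
  then have "l0 = - (l1 i * cos (\<theta> t) + l2 i * sin (\<theta> t))"
    using l3 by simp
  \<comment> \<open>The added square is zero by \<open>par\<close>. It completes the squared length
    of \<open>(l1 i, l2 i)\<close> in the orthonormal frame given by the heading and its
    normal.\<close>
  then have "l0\<^sup>2 = (l1 i * cos (\<theta> t) + l2 i * sin (\<theta> t))\<^sup>2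
      + (l1 i * sin (\<theta> t) - l2 i * cos (\<theta> t))\<^sup>2"
    using par[OF t] by (simp only: power2_minus) simp
  also have "\<dots> = ((l1 i)\<^sup>2 + (l2 i)\<^sup>2) * ((sin (\<theta> t))\<^sup>2 + (cos (\<theta> t))\<^sup>2)"
    by algebra
  finally have sq: "(l1 i)\<^sup>2 + (l2 i)\<^sup>2 = l0\<^sup>2"
    by simp
  have rho: "rho l1 l2 i = l0"
    using l0 by (simp add: rho_def sq)
  \<comment> \<open>If \<open>l0\<close> were zero, \<open>sq\<close> would force
    \<open>l1 i = l2 i = 0\<close>; as \<open>l3 t = 0\<close> too, all multipliers would vanish at
    \<open>t\<close>.\<close>
  have nz: "l0 \<noteq> 0"
    using nontriv[of t] t IA l3 sq by (auto simp: sum_power2_eq_zero_iff)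
  have "(l1 i, l2 i) \<noteq> (0, 0)"
    using nz sq by auto
  then have "sin (\<theta> t - \<theta> s) = 0" if "s \<in> I" "t \<in> I" for s t
    using sin_diff_eq_0_if_parallel par that by blast
  moreover have "continuous_on I \<theta>"
    using ode IT lipschitz_on_continuous_on continuous_on_subset
    unfolding solves_ode_ae_def by blast
  moreover have "connected I"
    by (simp add: I_def)
  ultimately have const: "\<theta> constant_on I"
    by (intro constant_on_if_sin_diff_eq_0)
  then obtain c where c: "\<And>s. s \<in> I \<Longrightarrow> \<theta> s = c"
    unfolding constant_on_def by blast
  \<comment> \<open>The control is the derivative of \<open>\<theta>\<close> only almost everywhere,
    so constancy of \<open>\<theta>\<close> yields \<open>u t = 0\<close> up to a null set.\<close>
  have "AE t in lebesgue_on {0..\<tau> N}. (\<theta> has_real_derivative u t) (at t within {0..\<tau> N})"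
    using ode by (simp add: solves_ode_ae_def)
  then have "AE t in lebesgue_on I. (\<theta> has_real_derivative u t) (at t within {0..\<tau> N})"
    using IT meas by (rule AE_lebesgue_on_subset) simp
  then have ae: "AE t in lebesgue_on I. u t = 0"
    using AE_space
  proof eventually_elim
    case (elim t)
    then show ?case
      using has_real_derivative_Ico_const_unique[of \<theta> "u t" t _ \<zeta>\<^sub>1 \<zeta>\<^sub>2 c] IT c
      by (simp add: I_def)
  qed
  have "l0 > 0"
    using l0 nz by simp
  then show ?thesis
    using rho const ae by (simp only: normal_Pc_def I_def simp_thms)
qed

end
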